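(* Let $(G,\beta)$ be an edge-labeled graph (in the setting described in the context) with vertices $v_1,\dots,v_n$, and let $(G_{red},\beta_{red})$ be the reduced graph associated to the vertex $v_n$. Then the map $\psi:\hat R_G\to\hat R_{G_{red}}$, $\psi(f_{v_1},\dots,f_{v_{n-1}},f_{v_n})=(f_{v_1},\dots,f_{v_{n-1}})$, is a surjective $\mathbb{Z}$-module homomorphism whose kernel is $\hat{\mathcal F}_n\cup\{(0,\dots,0)\}$, a submodule of rank $1$.
   Context: Setting: $G$ is a finite connected simple graph. Each vertex $v$ is labeled by $M_v=m_v\mathbb{Z}$ ($m_v\in\mathbb{Z}$), each edge $e$ by $\mathbb{Z}/r_e\mathbb{Z}$ ($r_e\in\mathbb{Z}$). A spline is $f\in\prod_v M_v$ with $f_u-f_v\in r_e\mathbb{Z}$ for every edge $e=uv$; $\hat R_G$ is the $\mathbb{Z}$-module of splines. An $i$-th flow-up class is a spline $F$ with $f_{v_i}\neq0$ and $f_{v_s}=0$ for all $s<i$; $\hat{\mathcal F}_i$ is the set of these. $(a,b,\dots)$ denotes gcd and $[a,b,\dots]$ lcm. Reduced graph associated to a vertex $v$: (1) delete $v$ and its incident edges; each neighbor $w$ of $v$ is kept with vertex module replaced by $[m_w,(m_v,r_{vw})]\mathbb{Z}$; for each pair of distinct neighbors $w,w'$ of $v$ add an edge $ww'$ labeled $(r_{vw},r_{vw'})$; (2) replace any set of parallel edges with labels $r_1,\dots,r_k$ by a single edge labeled $[r_1,\dots,r_k]$. The rank of a $\mathbb{Z}$-module is the size of a minimum generating set.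
   Formalization: The claim that the kernel has rank 1 is stated only when m_{v_n} and the labels r_e of all edges at v_n are nonzero; if one of these labels is 0, the kernel is {0}, of rank 0. All other claims are unconditional. *)

theory Defs
  imports "HOL-Algebra.Module" "HOL-Algebra.AbelCoset" "HOL-Algebra.IntRing"
begin

text \<open>Finite simple graphs whose vertices \<open>v\<close> carry the module \<open>vlab v \<cdot> \<int>\<close> and whose edges
  \<open>e = {u, w}\<close> carry \<open>\<int> / elab e \<cdot> \<int>\<close>. Labels are arbitrary integers, zero included; label values
  outside \<open>verts\<close> and \<open>edges\<close> are irrelevant.\<close>

record 'a labeled_graph =
  verts :: "'a set"
  edges :: "'a set set"
  vlab  :: "'a \<Rightarrow> int"
  elab  :: "'a set \<Rightarrow> int"

definition simple_graph :: "'a labeled_graph \<Rightarrow> bool" where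
  "simple_graph G \<longleftrightarrow> finite (verts G) \<and> (\<forall>e\<in>edges G. e \<subseteq> verts G \<and> card e = 2)"

definition connected_graph :: "'a labeled_graph \<Rightarrow> bool" where
  "connected_graph G \<longleftrightarrow> verts G \<noteq> {} \<and>
     (\<forall>u\<in>verts G. \<forall>w\<in>verts G. (u, w) \<in> {(x, y). {x, y} \<in> edges G}\<^sup>*)"

definition neighbors :: "'a labeled_graph \<Rightarrow> 'a \<Rightarrow> 'a set" where
  "neighbors G v = {w. {v, w} \<in> edges G}"

definition splines :: "'a labeled_graph \<Rightarrow> ('a \<Rightarrow> int) set" where
  "splines G = {f \<in> (\<Pi>\<^sub>E v\<in>verts G. {x. vlab G v dvd x}).
     \<forall>u w. {u, w} \<in> edges G \<longrightarrow> elab G {u, w} dvd f u - f w}"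

text \<open>The library's module record extends the ring record; its multiplicative part plays no role
  in the theory of modules and is left unspecified.\<close>

definition spline_module :: "'a labeled_graph \<Rightarrow> (int, 'a \<Rightarrow> int) module" where
  "spline_module G =
     \<lparr>carrier = splines G, monoid.mult = undefined, one = undefined,
      zero = (\<lambda>v\<in>verts G. 0),
      add = (\<lambda>f g. \<lambda>v\<in>verts G. f v + g v),
      smult = (\<lambda>c f. \<lambda>v\<in>verts G. c * f v)\<rparr>"

definition flow_up_classes :: "'a labeled_graph \<Rightarrow> (nat \<Rightarrow> 'a) \<Rightarrow> nat \<Rightarrow> ('a \<Rightarrow> int) set" where
  "flow_up_classes G v i =
     {f \<in> splines G. f (v i) \<noteq> 0 \<and> (\<forall>s. 1 \<le> s \<and> s < i \<longrightarrow> f (v s) = 0)}"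

text \<open>The labeled edges, as pairs of an edge and its label, of the multigraph obtained by deleting
  \<open>v\<close> and joining its neighbors pairwise. Parallel edges with equal labels are identified, which
  does not affect the least common multiple of the labels.\<close>

definition reduction_multi_edges :: "'a labeled_graph \<Rightarrow> 'a \<Rightarrow> ('a set \<times> int) set" where
  "reduction_multi_edges G v =
     {(e, elab G e) | e. e \<in> edges G \<and> v \<notin> e} \<union>
     {({w, w'}, gcd (elab G {v, w}) (elab G {v, w'})) | w w'.
        w \<in> neighbors G v \<and> w' \<in> neighbors G v \<and> w \<noteq> w'}"

definition reduced_graph :: "'a labeled_graph \<Rightarrow> 'a \<Rightarrow> 'a labeled_graph" where
  "reduced_graph G v =
     \<lparr>verts = verts G - {v},
      edges = fst ` reduction_multi_edges G v,
      vlab = (\<lambda>w. if w \<in> neighbors G v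
                  then lcm (vlab G w) (gcd (vlab G v) (elab G {v, w}))
                  else vlab G w),
      elab = (\<lambda>e. Lcm {r. (e, r) \<in> reduction_multi_edges G v})\<rparr>"

definition is_module_hom ::
  "('r, 'x) ring_scheme \<Rightarrow> ('r, 'b, 'y) module_scheme \<Rightarrow> ('r, 'c, 'z) module_scheme \<Rightarrow>
   ('b \<Rightarrow> 'c) \<Rightarrow> bool" where
  "is_module_hom R M N h \<longleftrightarrow> module R M \<and> module R N \<and> h \<in> carrier M \<rightarrow> carrier N \<and>
     (\<forall>x\<in>carrier M. \<forall>y\<in>carrier M. h (x \<oplus>\<^bsub>M\<^esub> y) = h x \<oplus>\<^bsub>N\<^esub> h y) \<and>
     (\<forall>a\<in>carrier R. \<forall>x\<in>carrier M. h (a \<odot>\<^bsub>M\<^esub> x) = a \<odot>\<^bsub>N\<^esub> h x)"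

definition generated_submodule ::
  "('r, 'x) ring_scheme \<Rightarrow> ('r, 'b, 'y) module_scheme \<Rightarrow> 'b set \<Rightarrow> 'b set" where
  "generated_submodule R M S = \<Inter> {N. submodule N R M \<and> S \<subseteq> N}"

definition generating_set ::
  "('r, 'x) ring_scheme \<Rightarrow> ('r, 'b, 'y) module_scheme \<Rightarrow> 'b set \<Rightarrow> bool" where
  "generating_set R M S \<longleftrightarrow> S \<subseteq> carrier M \<and> generated_submodule R M S = carrier M"

text \<open>Rank in the sense of the size of a minimum generating set, as a relation, since it is
  undefined for modules that are not finitely generated. The zero module has rank 0.\<close>

definition has_rank ::
  "('r, 'x) ring_scheme \<Rightarrow> ('r, 'b, 'y) module_scheme \<Rightarrow> nat \<Rightarrow> bool" where
  "has_rank R M k \<longleftrightarrow>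
     (\<exists>S. finite S \<and> generating_set R M S \<and> card S = k) \<and>
     (\<forall>S. finite S \<and> generating_set R M S \<longrightarrow> k \<le> card S)"

end

theory Submission
  imports Defs
begin

text \<open>Extending a spline of the reduced graph over the deleted vertex \<open>u\<close> means solving a system of
  congruences with one condition from the module at \<open>u\<close> and one from every edge at \<open>u\<close>. The labels
  of the reduced graph express exactly that this system is pairwise compatible, so the Chinese
  remainder theorem for moduli that need not be coprime solves it. The kernel consists of the
  splines supported at \<open>u\<close>, and these are the multiples of the least common multiple of the
  labels around \<open>u\<close>.\<close>

section \<open>Congruences with moduli that need not be coprime\<close>

text \<open>Divisibility makes the integers a distributive lattice, so gcd distributes over Lcm.
  This turns compatibility with each modulus in a family into compatibility with their Lcm.\<close>

lemma gcd_Lcm_dvd_iff: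
  fixes m a :: int and r :: "'i \<Rightarrow> int"
  assumes "finite I"
  shows "gcd m (Lcm (r ` I)) dvd a \<longleftrightarrow> (\<forall>i\<in>I. gcd m (r i) dvd a)"
  using assms
proof (induction I)
  case (insert i I)
  have "gcd m (Lcm (r ` insert i I)) = lcm (gcd m (r i)) (gcd m (Lcm (r ` I)))"
    by (simp add: gcd_lcm_distrib)
  then show ?case using insert.IH by simp
qed simp

text \<open>By induction on the index set: a solution for \<open>I\<close> may be shifted by any
  multiple of the Lcm of its moduli, so adding a congruence only involves two moduli,
  \<open>r i\<close> and that Lcm.\<close>

lemma generalized_chinese_remainder:
  fixes r a :: "'i \<Rightarrow> int"
  assumes "finite I"
    and "\<And>i j. i \<in> I \<Longrightarrow> j \<in> I \<Longrightarrow> i \<noteq> j \<Longrightarrow> gcd (r i) (r j) dvd a i - a j"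
  shows "\<exists>x. \<forall>i\<in>I. r i dvd x - a i"
  using assms
proof (induction I)
  case (insert i I)
  then obtain x where x: "\<And>j. j \<in> I \<Longrightarrow> r j dvd x - a j" by blast
  \<comment> \<open>The old solution and the new residue are compared through \<open>a j\<close>, to
    which both are congruent modulo the gcd.\<close>
  have "gcd (r i) (r j) dvd x - a i" if "j \<in> I" for j
  proof -
    have "gcd (r i) (r j) dvd x - a j"
      using x[OF that] by (meson dvd_trans gcd_dvd2)
    moreover have "gcd (r i) (r j) dvd a i - a j"
      using insert.prems insert.hyps that by blast
    ultimately have "gcd (r i) (r j) dvd (x - a j) - (a i - a j)" by (rule dvd_diff)
    then show ?thesis by simp
  qed
  then have "gcd (r i) (Lcm (r ` I)) dvd x - a i"
    by (simp add: gcd_Lcm_dvd_iff insert.hyps)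
  then obtain k where k: "x - a i = gcd (r i) (Lcm (r ` I)) * k" by (elim dvdE)
  obtain p q where "p * r i + q * Lcm (r ` I) = gcd (r i) (Lcm (r ` I))"
    using bezout_int by blast
  with k have split: "x - a i = p * k * r i + q * k * Lcm (r ` I)"
    by (metis mult.commute mult.left_commute distrib_left)
  \<comment> \<open>Subtracting a multiple of the Lcm keeps every old congruence, and the Bezout
    coefficient is chosen so that \<open>y - a i\<close> is a multiple of
    \<open>r i\<close>.\<close>
  define y where "y = x - q * k * Lcm (r ` I)"
  have "r i dvd y - a i"
  proof -
    have "y - a i = p * k * r i" using split by (simp add: y_def)
    then show ?thesis by simp
  qed
  moreover have "r j dvd y - a j" if "j \<in> I" for j
  proof -
    have "r j dvd q * k * Lcm (r ` I)" using that by (simp add: dvd_Lcm)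
    then have "r j dvd (x - a j) - q * k * Lcm (r ` I)" using x[OF that] by (rule dvd_diff[rotated])
    then show ?thesis by (simp add: y_def algebra_simps)
  qed
  ultimately show ?case by blast
qed simp

section \<open>Submodules, kernels and rank\<close>

text \<open>Negation is scalar multiplication by minus one, so closure under additive inverses comes
  for free.\<close>

lemma (in module) submoduleI_smult:
  assumes "H \<subseteq> carrier M" and "\<zero>\<^bsub>M\<^esub> \<in> H"
    and "\<And>x y. x \<in> H \<Longrightarrow> y \<in> H \<Longrightarrow> x \<oplus>\<^bsub>M\<^esub> y \<in> H"
    and smult: "\<And>a x. a \<in> carrier R \<Longrightarrow> x \<in> H \<Longrightarrow> a \<odot>\<^bsub>M\<^esub> x \<in> H"
  shows "submodule H R M"
proof (rule submoduleI)
  fix x assume "x \<in> H"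
  then have "\<ominus>\<^bsub>M\<^esub> x = (\<ominus> \<one>) \<odot>\<^bsub>M\<^esub> x"
    using assms(1) by (simp add: subset_iff smult_l_minus)
  then show "\<ominus>\<^bsub>M\<^esub> x \<in> H" using smult \<open>x \<in> H\<close> by simp
qed (use assms in auto)

lemma submodule_a_kernel:
  assumes hom: "is_module_hom R M N h"
  shows "submodule (a_kernel M N h) R M"
proof -
  interpret M: module R M using hom by (simp add: is_module_hom_def)
  interpret N: module R N using hom by (simp add: is_module_hom_def)
  have h: "h \<in> carrier M \<rightarrow> carrier N"
    and add: "\<And>x y. x \<in> carrier M \<Longrightarrow> y \<in> carrier M \<Longrightarrow> h (x \<oplus>\<^bsub>M\<^esub> y) = h x \<oplus>\<^bsub>N\<^esub> h y"
    and smult: "\<And>a x. a \<in> carrier R \<Longrightarrow> x \<in> carrier M \<Longrightarrow> h (a \<odot>\<^bsub>M\<^esub> x) = a \<odot>\<^bsub>N\<^esub> h x"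
    using hom by (auto simp: is_module_hom_def)
  \<comment> \<open>Preservation of zero is not part of \<open>is_module_hom\<close>; it follows
    from compatibility with the scalar 0.\<close>
  have "h \<zero>\<^bsub>M\<^esub> = h (\<zero>\<^bsub>R\<^esub> \<odot>\<^bsub>M\<^esub> \<zero>\<^bsub>M\<^esub>)" by simp
  also have "\<dots> = \<zero>\<^bsub>R\<^esub> \<odot>\<^bsub>N\<^esub> h \<zero>\<^bsub>M\<^esub>" by (intro smult) auto
  also have "\<dots> = \<zero>\<^bsub>N\<^esub>" using h by (intro N.smult_l_null) auto
  finally have "h \<zero>\<^bsub>M\<^esub> = \<zero>\<^bsub>N\<^esub>" .
  then show ?thesis
    by (intro M.submoduleI_smult) (auto simp: a_kernel_def' add smult)
qed

text \<open>The generator gives the upper bound. For the lower bound, the empty set generates only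
  the zero submodule, which misses \<open>g\<close>.\<close>

lemma has_rank_1_cyclic:
  assumes "module R M" and g: "g \<in> carrier M" "g \<noteq> \<zero>\<^bsub>M\<^esub>"
    and cyclic: "\<And>x. x \<in> carrier M \<Longrightarrow> \<exists>a\<in>carrier R. x = a \<odot>\<^bsub>M\<^esub> g"
  shows "has_rank R M 1"
proof -
  interpret module R M by fact
  have "carrier M \<subseteq> N" if "submodule N R M" "g \<in> N" for N
  proof
    fix x assume "x \<in> carrier M"
    then obtain a where "a \<in> carrier R" "x = a \<odot>\<^bsub>M\<^esub> g" using cyclic by blast
    then show "x \<in> N" using submoduleE(4)[OF that(1)] that(2) by simp
  qed
  then have "generating_set R M {g}"
    using g carrier_is_submodule
    by (auto simp: generating_set_def generated_submodule_def)
  moreover have "S \<noteq> {}" if "generating_set R M S" for S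
  proof
    assume "S = {}"
    moreover have "submodule {\<zero>\<^bsub>M\<^esub>} R M" by (rule submoduleI_smult) auto
    ultimately have "carrier M \<subseteq> {\<zero>\<^bsub>M\<^esub>}"
      using that by (auto simp: generating_set_def generated_submodule_def)
    then show False using g by blast
  qed
  ultimately show ?thesis
    by (auto simp: has_rank_def Suc_le_eq card_gt_0_iff intro!: exI[of _ "{g}"])
qed

section \<open>The module of splines\<close>

lemma splines_iff:
  "f \<in> splines G \<longleftrightarrow> f \<in> extensional (verts G) \<and> (\<forall>v\<in>verts G. vlab G v dvd f v) \<and>
     (\<forall>u w. {u, w} \<in> edges G \<longrightarrow> elab G {u, w} dvd f u - f w)"
  by (auto simp: splines_def PiE_iff)

lemma spline_module_sel [simp]:
  "carrier (spline_module G) = splines G"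
  "\<zero>\<^bsub>spline_module G\<^esub> = (\<lambda>v\<in>verts G. 0)"
  "f \<oplus>\<^bsub>spline_module G\<^esub> g = (\<lambda>v\<in>verts G. f v + g v)"
  "c \<odot>\<^bsub>spline_module G\<^esub> f = (\<lambda>v\<in>verts G. c * f v)"
  by (simp_all add: spline_module_def)

text \<open>Edge conditions are linear in the spline. Allowing two coefficients covers sums,
  negatives and scalar multiples at once.\<close>

lemma splines_add_smult:
  assumes verts: "\<And>e. e \<in> edges G \<Longrightarrow> e \<subseteq> verts G" and fg: "f \<in> splines G" "g \<in> splines G"
  shows "(\<lambda>v\<in>verts G. a * f v + b * g v) \<in> splines G"
proof -
  have "elab G {u, w} dvd (a * f u + b * g u) - (a * f w + b * g w)" if "{u, w} \<in> edges G" for u w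
  proof -
    have "elab G {u, w} dvd a * (f u - f w) + b * (g u - g w)"
      using fg that by (auto simp: splines_iff)
    then show ?thesis by (simp add: algebra_simps)
  qed
  then show ?thesis using fg verts by (fastforce simp: splines_iff)
qed

text \<open>Assuming only that edges lie inside the vertex set lets this apply to \<open>G\<close>
  and to its reduced graph alike.\<close>

lemma module_spline_module:
  assumes verts: "\<And>e. e \<in> edges G \<Longrightarrow> e \<subseteq> verts G"
  shows "module \<Z> (spline_module G)"
proof (rule moduleI)
  have zero: "(\<lambda>v\<in>verts G. 0) \<in> splines G"
    using verts by (fastforce simp: splines_iff)
  show "abelian_group (spline_module G)"
  proof (rule abelian_groupI)
    fix f assume "f \<in> carrier (spline_module G)"
    then have "(\<lambda>v\<in>verts G. - f v) \<in> splines G"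
      using splines_add_smult[OF verts, of f f "-1" 0] by simp
    then show "\<exists>g\<in>carrier (spline_module G). g \<oplus>\<^bsub>spline_module G\<^esub> f = \<zero>\<^bsub>spline_module G\<^esub>"
      by (intro bexI[of _ "\<lambda>v\<in>verts G. - f v"]) (auto cong: restrict_cong)
    show "\<zero>\<^bsub>spline_module G\<^esub> \<oplus>\<^bsub>spline_module G\<^esub> f = f"
      using \<open>f \<in> carrier (spline_module G)\<close>
      by (auto simp: splines_iff extensional_def fun_eq_iff)
  qed (use zero splines_add_smult[OF verts, where a = 1 and b = 1]
        in \<open>auto simp: fun_eq_iff restrict_def\<close>)
next
  fix a f assume "a \<in> carrier \<Z>" "f \<in> carrier (spline_module G)"
  then show "a \<odot>\<^bsub>spline_module G\<^esub> f \<in> carrier (spline_module G)"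
    using splines_add_smult[OF verts, of f f a 0] by simp
qed (auto simp: int_is_cring splines_iff extensional_def fun_eq_iff algebra_simps)

section \<open>Splines of the reduced graph\<close>

lemma simple_graph_edge_subset: "simple_graph G \<Longrightarrow> e \<in> edges G \<Longrightarrow> e \<subseteq> verts G"
  by (simp add: simple_graph_def)

lemma simple_graph_loop_free: "simple_graph G \<Longrightarrow> {u, u} \<notin> edges G"
  by (force simp: simple_graph_def)

lemma neighbors_subset: "simple_graph G \<Longrightarrow> neighbors G u \<subseteq> verts G - {u}"
  using simple_graph_edge_subset[of G] simple_graph_loop_free[of G u]
  by (auto simp: neighbors_def)

lemma reduced_graph_edge_subset:
  assumes "simple_graph G" "e \<in> edges (reduced_graph G u)"
  shows "e \<subseteq> verts (reduced_graph G u)"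
proof -
  consider "e \<in> edges G" "u \<notin> e" | "e \<subseteq> neighbors G u"
    using assms(2) by (auto simp: reduced_graph_def reduction_multi_edges_def)
  then show ?thesis
    using neighbors_subset[OF assms(1), of u] simple_graph_edge_subset[OF assms(1), of e]
    by cases (auto simp: reduced_graph_def)
qed

text \<open>An lcm divides a number exactly when all its arguments do, so the merged labels split
  into separate conditions. The last two conjuncts are the pairwise compatibility of the congruences
  that a value at \<open>u\<close> must satisfy.\<close>

lemma reduced_graph_splines_iff:
  assumes "simple_graph G"
  shows "f \<in> splines (reduced_graph G u) \<longleftrightarrow>
    f \<in> extensional (verts G - {u}) \<and>
    (\<forall>w\<in>verts G - {u}. vlab G w dvd f w) \<and>
    (\<forall>w w'. {w, w'} \<in> edges G \<and> u \<notin> {w, w'} \<longrightarrow> elab G {w, w'} dvd f w - f w') \<and>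
    (\<forall>w\<in>neighbors G u. gcd (vlab G u) (elab G {u, w}) dvd f w) \<and>
    (\<forall>w\<in>neighbors G u. \<forall>w'\<in>neighbors G u. w \<noteq> w' \<longrightarrow>
       gcd (elab G {u, w}) (elab G {u, w'}) dvd f w - f w')"
    (is "?l \<longleftrightarrow> ?r")
proof -
  let ?E = "reduction_multi_edges G u"
  have "(\<forall>w w'. {w, w'} \<in> edges (reduced_graph G u) \<longrightarrow>
           elab (reduced_graph G u) {w, w'} dvd f w - f w') \<longleftrightarrow>
        (\<forall>w w' r. ({w, w'}, r) \<in> ?E \<longrightarrow> r dvd f w - f w')"
    by (force simp: reduced_graph_def Lcm_dvd_iff)
  also have "\<dots> \<longleftrightarrow>
    (\<forall>w w'. {w, w'} \<in> edges G \<and> u \<notin> {w, w'} \<longrightarrow> elab G {w, w'} dvd f w - f w') \<and>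
    (\<forall>w\<in>neighbors G u. \<forall>w'\<in>neighbors G u. w \<noteq> w' \<longrightarrow>
       gcd (elab G {u, w}) (elab G {u, w'}) dvd f w - f w')"
    (is "?A \<longleftrightarrow> ?B \<and> ?C")
  proof
    assume ?A
    then show "?B \<and> ?C" unfolding reduction_multi_edges_def by blast
  next
    assume BC: "?B \<and> ?C"
    show ?A
    proof (intro allI impI)
      fix w w' r assume "({w, w'}, r) \<in> ?E"
      then consider "{w, w'} \<in> edges G" "u \<notin> {w, w'}" "r = elab G {w, w'}"
        | x y where "x \<in> neighbors G u" "y \<in> neighbors G u" "x \<noteq> y" "{w, w'} = {x, y}"
            "r = gcd (elab G {u, x}) (elab G {u, y})"
        unfolding reduction_multi_edges_def by blast
      then show "r dvd f w - f w'"
      proof cases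
        case 1
        then show ?thesis using BC by blast
      next
        case 2
        then have "r dvd f x - f y" using BC by blast
        \<comment> \<open>The unordered pair may match in either orientation; divisibility of a
          difference ignores its sign.\<close>
        then show ?thesis using \<open>{w, w'} = {x, y}\<close>
          by (auto simp: doubleton_eq_iff dvd_diff_commute)
      qed
    qed
  qed
  finally show ?thesis
    using neighbors_subset[OF assms, of u]
    by (auto simp: splines_iff reduced_graph_def)
qed

section \<open>Restriction to the reduced graph and its surjectivity\<close>

text \<open>The value \<open>f u\<close> solves the system of congruences at \<open>u\<close>;
  eliminating it from any two of them gives the compatibility conditions.\<close>

lemma spline_restrict_reduced:
  assumes G: "simple_graph G" and u: "u \<in> verts G" and f: "f \<in> splines G"
  shows "restrict f (verts G - {u}) \<in> splines (reduced_graph G u)"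
proof -
  have nb: "w \<in> verts G - {u}" "elab G {u, w} dvd f u - f w" if "w \<in> neighbors G u" for w
    using that f neighbors_subset[OF G, of u] by (auto simp: splines_iff neighbors_def)
  have m: "vlab G u dvd f u" using f u by (simp add: splines_iff)
  have "gcd (vlab G u) (elab G {u, w}) dvd f w" if "w \<in> neighbors G u" for w
  proof -
    have "gcd (vlab G u) (elab G {u, w}) dvd f u - (f u - f w)"
      using dvd_trans[OF gcd_dvd1 m] dvd_trans[OF gcd_dvd2 nb(2)[OF that]] by (rule dvd_diff)
    then show ?thesis by simp
  qed
  moreover have "gcd (elab G {u, w}) (elab G {u, w'}) dvd f w - f w'"
    if "w \<in> neighbors G u" "w' \<in> neighbors G u" for w w'
  proof -
    have "gcd (elab G {u, w}) (elab G {u, w'}) dvd (f u - f w') - (f u - f w)"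
      using dvd_trans[OF gcd_dvd2 nb(2)[OF that(2)]] dvd_trans[OF gcd_dvd1 nb(2)[OF that(1)]]
      by (rule dvd_diff)
    then show ?thesis by simp
  qed
  moreover have "elab G {w, w'} dvd restrict f (verts G - {u}) w - restrict f (verts G - {u}) w'"
    if "{w, w'} \<in> edges G \<and> u \<notin> {w, w'}" for w w'
    using f that simple_graph_edge_subset[OF G, of "{w, w'}"] by (auto simp: splines_iff)
  moreover have "vlab G w dvd f w" if "w \<in> verts G" for w
    using f that by (simp add: splines_iff)
  ultimately show ?thesis
    unfolding reduced_graph_splines_iff[OF G]
    by (intro conjI ballI allI impI) (simp_all only: restrict_extensional restrict_apply' nb(1) DiffD1)
qed

lemma spline_extend_reduced:
  assumes G: "simple_graph G" and u: "u \<in> verts G" and g: "g \<in> splines (reduced_graph G u)"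
  obtains f where "f \<in> splines G" "restrict f (verts G - {u}) = g"
proof -
  let ?N = "neighbors G u"
  note g' = g[unfolded reduced_graph_splines_iff[OF G]]
  have uN: "u \<notin> ?N" and "finite ?N"
    using neighbors_subset[OF G, of u] G by (auto simp: simple_graph_def intro: finite_subset)
  \<comment> \<open>The index \<open>u\<close>, which is not its own neighbor, is free to carry the
    module condition at \<open>u\<close>: modulus \<open>vlab G u\<close>, residue 0.\<close>
  define r where "r w = (if w = u then vlab G u else elab G {u, w})" for w
  define a where "a w = (if w = u then 0 else g w)" for w
  \<comment> \<open>Pairs containing \<open>u\<close> are compatible by the new vertex labels, pairs
    of neighbors by the new edges.\<close>
  have "\<exists>x. \<forall>w\<in>insert u ?N. r w dvd x - a w"
    using \<open>finite ?N\<close> g' uN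
    by (intro generalized_chinese_remainder) (auto simp: r_def a_def gcd.commute)
  then obtain x where x: "\<forall>w\<in>insert u ?N. r w dvd x - a w" ..
  have xu: "vlab G u dvd x" using x by (auto simp: r_def a_def)
  have xN: "elab G {u, w} dvd x - g w" if "w \<in> ?N" for w
    using x that uN by (auto simp: r_def a_def split: if_splits)
  define f where "f = g(u := x)"
  have "elab G {w, w'} dvd f w - f w'" if e: "{w, w'} \<in> edges G" for w w'
  proof -
    consider "w = u" "w' \<noteq> u" | "w \<noteq> u" "w' = u" | "w \<noteq> u" "w' \<noteq> u"
      using simple_graph_loop_free[OF G] e by metis
    then show ?thesis
    proof cases
      case 1
      then show ?thesis using xN[of w'] e by (simp add: f_def neighbors_def)
    next
      case 2
      then show ?thesis using xN[of w] e
        by (simp add: f_def neighbors_def insert_commute dvd_diff_commute)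
    next
      case 3
      then show ?thesis using g' e by (simp add: f_def)
    qed
  qed
  then have "f \<in> splines G"
    using g' xu u by (auto simp: splines_iff f_def extensional_def)
  moreover have "restrict f (verts G - {u}) = g"
    using g' by (auto simp: f_def fun_eq_iff extensional_def)
  ultimately show thesis by (rule that)
qed

lemma is_module_hom_restrict_reduced:
  assumes G: "simple_graph G" and u: "u \<in> verts G"
  shows "is_module_hom \<Z> (spline_module G) (spline_module (reduced_graph G u))
    (\<lambda>f. restrict f (verts G - {u}))"
proof -
  have "verts (reduced_graph G u) = verts G - {u}" by (simp add: reduced_graph_def)
  then show ?thesis
    using module_spline_module[OF simple_graph_edge_subset[OF G]]
      module_spline_module[OF reduced_graph_edge_subset[OF G]] spline_restrict_reduced[OF G u]
    by (auto simp: is_module_hom_def fun_eq_iff)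
qed

section \<open>The kernel, flow-up classes and rank\<close>

text \<open>An edge at \<open>u\<close> compares \<open>x\<close> with 0, while any other edge
  compares 0 with 0.\<close>

lemma supported_spline_iff:
  assumes G: "simple_graph G" and u: "u \<in> verts G"
  shows "(\<lambda>w\<in>verts G. if w = u then x else 0) \<in> splines G \<longleftrightarrow>
    lcm (vlab G u) (Lcm (elab G ` {e \<in> edges G. u \<in> e})) dvd x"
    (is "?f \<in> _ \<longleftrightarrow> _")
proof -
  have e: "w \<in> verts G" "w' \<in> verts G" "w \<noteq> w'" if "{w, w'} \<in> edges G" for w w'
    using simple_graph_edge_subset[OF G that] simple_graph_loop_free[OF G] that by auto
  have "(\<forall>w w'. {w, w'} \<in> edges G \<longrightarrow> elab G {w, w'} dvd ?f w - ?f w') \<longleftrightarrow>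
    (\<forall>e\<in>edges G. u \<in> e \<longrightarrow> elab G e dvd x)" (is "?l \<longleftrightarrow> ?r")
  proof
    assume l: ?l
    show ?r
    proof (intro ballI impI)
      fix e assume e': "e \<in> edges G" "u \<in> e"
      then have "card e = 2" using G by (simp add: simple_graph_def)
      then obtain w where w: "e = {u, w}" using e'(2) by (auto simp: card_2_iff)
      then show "elab G e dvd x" using l[rule_format, of u w] e[of u w] e' by simp
    qed
  next
    assume ?r
    then show ?l using e by auto
  qed
  then show ?thesis using u by (auto simp: splines_iff Lcm_dvd_iff)
qed

text \<open>Translates between the numbering of the vertices and the removal of the last
  one.\<close>

lemma bij_betw_image_butlast:
  assumes bij: "bij_betw v {1..n} V" and n: "n \<ge> (1::nat)"
  shows "v ` {1..<n} = V - {v n}"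
proof -
  have "v ` ({1..n} - {n}) = v ` {1..n} - v ` {n}"
    using bij n by (intro inj_on_image_set_diff[of v "{1..n}"]) (auto simp: bij_betw_def)
  moreover have "{1..n} - {n} = {1..<n}" by auto
  ultimately show ?thesis using bij by (simp add: bij_betw_def)
qed

lemma a_kernel_restrict_reduced:
  "a_kernel (spline_module G) (spline_module (reduced_graph G u)) (\<lambda>f. restrict f (verts G - {u})) =
    {f \<in> splines G. \<forall>w\<in>verts G - {u}. f w = 0}"
  by (auto simp: a_kernel_def' reduced_graph_def fun_eq_iff)

text \<open>For the last index the vanishing conditions reach every other vertex, and adjoining the
  zero spline cancels the condition that the value at \<open>v n\<close> be nonzero.\<close>

lemma flow_up_classes_last:
  assumes G: "simple_graph G" and bij: "bij_betw v {1..n} (verts G)" and n: "n \<ge> 1"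
  shows "flow_up_classes G v n \<union> {\<lambda>w\<in>verts G. 0} =
    {f \<in> splines G. \<forall>w\<in>verts G - {v n}. f w = 0}"
proof -
  have vanish: "(\<forall>s. 1 \<le> s \<and> s < n \<longrightarrow> f (v s) = 0) \<longleftrightarrow> (\<forall>w\<in>verts G - {v n}. f w = 0)"
    for f :: "'a \<Rightarrow> int"
    using bij_betw_image_butlast[OF bij n, symmetric] by auto
  have "(\<lambda>w\<in>verts G. 0) \<in> splines G"
    using simple_graph_edge_subset[OF G] by (fastforce simp: splines_iff)
  moreover have "f \<in> {\<lambda>w\<in>verts G. 0}"
    if "f \<in> splines G" "\<forall>w\<in>verts G - {v n}. f w = 0" "f (v n) = 0" for f
  proof -
    have "f = (\<lambda>w\<in>verts G. 0)"
    proof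
      fix w show "f w = (\<lambda>w\<in>verts G. 0) w"
        using that by (cases "w = v n") (auto simp: splines_iff extensional_def)
    qed
    then show ?thesis by simp
  qed
  moreover have "\<forall>w\<in>verts G - {v n}. (\<lambda>w\<in>verts G. 0 :: int) w = 0" by simp
  ultimately show ?thesis
    unfolding flow_up_classes_def vanish by blast
qed

text \<open>The spline with value \<open>L\<close> at \<open>u\<close> and 0 elsewhere generates. If
  the label of \<open>u\<close> or of an edge at \<open>u\<close> were 0, then \<open>L\<close>
  would be 0 and the module trivial, of rank 0.\<close>

lemma has_rank_1_supported_splines:
  assumes G: "simple_graph G" and u: "u \<in> verts G"
    and nz: "vlab G u \<noteq> 0" "\<forall>e\<in>edges G. u \<in> e \<longrightarrow> elab G e \<noteq> 0"
  shows "has_rank \<Z>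
    ((spline_module G)\<lparr>carrier := {f \<in> splines G. \<forall>w\<in>verts G - {u}. f w = 0}\<rparr>) 1"
proof -
  let ?K = "{f \<in> splines G. \<forall>w\<in>verts G - {u}. f w = 0}"
  define L where "L = lcm (vlab G u) (Lcm (elab G ` {e \<in> edges G. u \<in> e}))"
  define s where "s x = (\<lambda>w\<in>verts G. if w = u then x else 0)" for x :: int
  have s_iff: "s x \<in> splines G \<longleftrightarrow> L dvd x" for x
    unfolding s_def L_def by (rule supported_spline_iff[OF G u])
  \<comment> \<open>The Lcm of an infinite set of integers is 0, so finiteness enters the proof that
    \<open>L\<close> is nonzero.\<close>
  have "finite (edges G)"
    using G by (auto simp: simple_graph_def intro: finite_subset[of _ "Pow (verts G)"])
  then have "L \<noteq> 0"
    using nz by (auto simp: L_def Lcm_0_iff)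
  have sub: "submodule ?K \<Z> (spline_module G)"
    using submodule_a_kernel[OF is_module_hom_restrict_reduced[OF G u]]
    by (simp only: a_kernel_restrict_reduced)
  show ?thesis
  proof (rule has_rank_1_cyclic)
    show "module \<Z> ((spline_module G)\<lparr>carrier := ?K\<rparr>)"
      by (rule submodule.submodule_is_module[OF sub
            module_spline_module[OF simple_graph_edge_subset[OF G]]])
    show "s L \<in> carrier ((spline_module G)\<lparr>carrier := ?K\<rparr>)"
      using s_iff[of L] by (simp add: s_def)
    show "s L \<noteq> \<zero>\<^bsub>(spline_module G)\<lparr>carrier := ?K\<rparr>\<^esub>"
      using \<open>L \<noteq> 0\<close> u by (auto simp: s_def fun_eq_iff)
    fix f assume "f \<in> carrier ((spline_module G)\<lparr>carrier := ?K\<rparr>)"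
    then have f: "f \<in> splines G" "\<forall>w\<in>verts G - {u}. f w = 0" by simp_all
    have "f = s (f u)"
      using f by (auto simp: s_def splines_iff extensional_def fun_eq_iff)
    with f s_iff obtain c where "f u = c * L" by (metis dvdE mult.commute)
    with \<open>f = s (f u)\<close> have "f = (\<lambda>w\<in>verts G. c * s L w)"
      by (auto simp: s_def fun_eq_iff split: if_splits)
    then show "\<exists>a\<in>carrier \<Z>. f = a \<odot>\<^bsub>(spline_module G)\<lparr>carrier := ?K\<rparr>\<^esub> s L"
      by auto
  qed
qed

theorem theorem4p4:
  fixes G :: "'a labeled_graph" and v :: "nat \<Rightarrow> 'a" and n :: nat
    and Gred :: "'a labeled_graph" and \<psi> :: "('a \<Rightarrow> int) \<Rightarrow> ('a \<Rightarrow> int)"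
  assumes "simple_graph G" and "connected_graph G"
    and "bij_betw v {1..n} (verts G)"
  defines "Gred \<equiv> reduced_graph G (v n)"
    and "\<psi> \<equiv> (\<lambda>f. restrict f (v ` {1..<n}))"
  shows "is_module_hom \<Z> (spline_module G) (spline_module Gred) \<psi> \<and>
    \<psi> ` carrier (spline_module G) = carrier (spline_module Gred) \<and>
    a_kernel (spline_module G) (spline_module Gred) \<psi> =
      flow_up_classes G v n \<union> {\<zero>\<^bsub>spline_module G\<^esub>} \<and>
    submodule (flow_up_classes G v n \<union> {\<zero>\<^bsub>spline_module G\<^esub>}) \<Z> (spline_module G) \<and>
    (vlab G (v n) \<noteq> 0 \<and> (\<forall>e\<in>edges G. v n \<in> e \<longrightarrow> elab G e \<noteq> 0) \<longrightarrow>
      has_rank \<Z> ((spline_module G)\<lparr>carrier := flow_up_classes G v n \<union> {\<zero>\<^bsub>spline_module G\<^esub>}\<rparr>) 1)"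
proof -
  note G = assms(1) and bij = assms(3)
  have "verts G \<noteq> {}" using assms(2) by (simp add: connected_graph_def)
  \<comment> \<open>Connectedness includes having a vertex; this ensures that \<open>v n\<close> is
    one.\<close>
  then have n: "n \<ge> 1" using bij by (cases n) (auto simp: bij_betw_def)
  then have u: "v n \<in> verts G" using bij by (auto simp: bij_betw_def)
  let ?K = "{f \<in> splines G. \<forall>w\<in>verts G - {v n}. f w = 0}"
  have \<psi>: "\<psi> = (\<lambda>f. restrict f (verts G - {v n}))"
    using bij_betw_image_butlast[OF bij n] by (simp add: \<psi>_def)
  have K: "flow_up_classes G v n \<union> {\<zero>\<^bsub>spline_module G\<^esub>} = ?K"
    using flow_up_classes_last[OF G bij n] by simp
  have hom: "is_module_hom \<Z> (spline_module G) (spline_module Gred) \<psi>"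
    unfolding \<psi> Gred_def by (rule is_module_hom_restrict_reduced[OF G u])
  have ker: "a_kernel (spline_module G) (spline_module Gred) \<psi> = ?K"
    unfolding \<psi> Gred_def by (rule a_kernel_restrict_reduced)
  have "\<psi> ` splines G = splines Gred"
    unfolding \<psi> Gred_def
    using spline_restrict_reduced[OF G u] spline_extend_reduced[OF G u] by blast
  then show ?thesis
    unfolding K
    using hom ker submodule_a_kernel[OF hom] has_rank_1_supported_splines[OF G u] by simp
qed

end
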